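(* Let $n,k\ge3$, $s\ge2$, $t\ge1$ and $0\le\alpha<1$. Let $H$ be a connected linear $k$-graph on $n$ vertices that contains neither a Berge-$B_s$ nor a Berge-$K_{2,t}$, let $\mathbf{x}$ be the $\alpha$-Perron vector of $H$, and let $u\in V(H)$ be a vertex whose entry in $\mathbf{x}$ is maximum. Then $$\rho_\alpha^2(H)\le \alpha d_u^2+(1-\alpha)\left[\frac{(t-1)(n-1)}{(k-1)^2}+\frac{(6k^2-15k+10)(s-1)-2(t-1)}{2(k-1)}\,d_u\right].$$
   Context: A $k$-graph ($k$-uniform hypergraph) $H$ consists of a finite vertex set $V(H)$ and a set $E(H)$ of $k$-element subsets of $V(H)$ (edges). $H$ is linear if any two distinct edges share at most one vertex. Two vertices are adjacent if some edge contains both; $H$ is connected if the graph on $V(H)$ with this adjacency relation is connected. The degree $d_v$ of a vertex $v$ is the number of edges containing $v$. For $V(H)=\{v_1,\dots,v_n\}$, the adjacency tensor $\mathcal{A}(H)=(a_{i_1\dots i_k})$ is the order-$k$, dimension-$n$ tensor with $a_{i_1\dots i_k}=\frac{1}{(k-1)!}$ if $\{v_{i_1},\dots,v_{i_k}\}\in E(H)$ and $0$ otherwise; $\mathcal{D}(H)$ is the diagonal tensor with entries $d_{i\dots i}=d_{v_i}$ and all other entries $0$. For $0\le\alpha<1$, $\mathcal{A}_\alpha(H)=\alpha\mathcal{D}(H)+(1-\alpha)\mathcal{A}(H)$. A number $\lambda\in\mathbb{C}$ is an eigenvalue of an order-$k$ dimension-$n$ tensor $\mathcal{A}=(a_{i_1\dots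 i_k})$ if there is a nonzero $\mathbf{x}\in\mathbb{C}^n$ with $\sum_{i_2,\dots,i_k=1}^n a_{i i_2\dots i_k}x_{i_2}\cdots x_{i_k}=\lambda x_i^{k-1}$ for all $i$; the spectral radius is the largest modulus of an eigenvalue. $\rho_\alpha(H)$ denotes the spectral radius of $\mathcal{A}_\alpha(H)$. For connected $H$, $\rho_\alpha(H)$ is an eigenvalue of $\mathcal{A}_\alpha(H)$ with an eigenvector having all entries positive, unique up to positive scaling; this is the $\alpha$-Perron vector of $H$. For a graph $G$, a hypergraph $F$ is a Berge-$G$ if there is a bijection $\varphi:E(G)\to E(F)$ with $e\subseteq\varphi(e)$ for every $e\in E(G)$; $H$ contains a Berge-$G$ if some subhypergraph of $H$ is a Berge-$G$. The $s$-book $B_s$ is the graph consisting of $s$ triangles sharing one common edge (vertices $x,y,w_1,\dots,w_s$, edges $xy$, $xw_i$, $yw_i$). $K_{2,t}$ is the complete bipartite graph with parts of sizes $2$ and $t$. *)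

theory Defs
  imports Complex_Main
begin

section \<open>Hypergraphs\<close>

record 'a hypergraph =
  verts :: "'a set"
  edges :: "'a set set"

definition wf_hypergraph :: "'a hypergraph \<Rightarrow> bool" where
  "wf_hypergraph H \<longleftrightarrow> finite (verts H) \<and> (\<forall>e\<in>edges H. e \<subseteq> verts H)"

definition k_graph :: "nat \<Rightarrow> 'a hypergraph \<Rightarrow> bool" where
  "k_graph k H \<longleftrightarrow> wf_hypergraph H \<and> (\<forall>e\<in>edges H. card e = k)"

definition linear_hypergraph :: "'a hypergraph \<Rightarrow> bool" where
  "linear_hypergraph H \<longleftrightarrow>
     (\<forall>e\<in>edges H. \<forall>f\<in>edges H. e \<noteq> f \<longrightarrow> card (e \<inter> f) \<le> 1)"

definition adjacent :: "'a hypergraph \<Rightarrow> 'a \<Rightarrow> 'a \<Rightarrow> bool" where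
  "adjacent H v w \<longleftrightarrow> (\<exists>e\<in>edges H. v \<in> e \<and> w \<in> e)"

definition connected_hypergraph :: "'a hypergraph \<Rightarrow> bool" where
  "connected_hypergraph H \<longleftrightarrow>
     verts H \<noteq> {} \<and> (\<forall>v\<in>verts H. \<forall>w\<in>verts H. (adjacent H)\<^sup>*\<^sup>* v w)"

definition degree :: "'a hypergraph \<Rightarrow> 'a \<Rightarrow> nat" where
  "degree H v = card {e \<in> edges H. v \<in> e}"

definition subhypergraph :: "'a hypergraph \<Rightarrow> 'a hypergraph \<Rightarrow> bool" where
  "subhypergraph F H \<longleftrightarrow>
     wf_hypergraph F \<and> verts F \<subseteq> verts H \<and> edges F \<subseteq> edges H"


section \<open>Berge hypergraphs\<close>

text \<open>
  The graph \<open>G\<close> matters only up to isomorphism, so the inclusion of \<open>e\<close> in \<open>\<phi> e\<close> is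
  read for the copy of \<open>G\<close> that the injection \<open>f\<close> places on the vertices of \<open>F\<close>.
\<close>

definition is_Berge :: "'b hypergraph \<Rightarrow> 'a hypergraph \<Rightarrow> bool" where
  "is_Berge G F \<longleftrightarrow>
     (\<exists>f \<phi>. inj_on f (verts G) \<and> f ` verts G \<subseteq> verts F \<and>
            bij_betw \<phi> (edges G) (edges F) \<and> (\<forall>e\<in>edges G. f ` e \<subseteq> \<phi> e))"

definition contains_Berge :: "'a hypergraph \<Rightarrow> 'b hypergraph \<Rightarrow> bool" where
  "contains_Berge H G \<longleftrightarrow> (\<exists>F. subhypergraph F H \<and> is_Berge G F)"

text \<open>The spine of the book is the edge \<open>{0, 1}\<close>.\<close>

definition book :: "nat \<Rightarrow> nat hypergraph" where
  "book s = \<lparr>verts = {0..s + 1},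
             edges = insert {0, 1} {{i, j} | i j. i \<in> {0, 1} \<and> j \<in> {2..s + 1}}\<rparr>"

text \<open>The parts are \<open>{0, 1}\<close> and \<open>{2..t + 1}\<close>.\<close>

definition K2 :: "nat \<Rightarrow> nat hypergraph" where
  "K2 t = \<lparr>verts = {0..t + 1},
           edges = {{i, j} | i j. i \<in> {0, 1} \<and> j \<in> {2..t + 1}}\<rparr>"


section \<open>Tensors and their eigenvalues\<close>

text \<open>
  A tensor of order \<open>k\<close> with index set \<open>I\<close> is a function on index tuples, represented by
  lists; only its values on \<open>index_tuples k I\<close> are relevant.
\<close>

definition index_tuples :: "nat \<Rightarrow> 'i set \<Rightarrow> 'i list set" where
  "index_tuples m I = {js. length js = m \<and> set js \<subseteq> I}"

definition tensor_eigenpair ::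
    "nat \<Rightarrow> 'i set \<Rightarrow> ('i list \<Rightarrow> complex) \<Rightarrow> complex \<Rightarrow> ('i \<Rightarrow> complex) \<Rightarrow> bool" where
  "tensor_eigenpair k I T l x \<longleftrightarrow>
     (\<exists>i\<in>I. x i \<noteq> 0) \<and>
     (\<forall>i\<in>I. (\<Sum>js\<in>index_tuples (k - 1) I. T (i # js) * prod_list (map x js)) = l * x i ^ (k - 1))"

definition tensor_eigenvalue :: "nat \<Rightarrow> 'i set \<Rightarrow> ('i list \<Rightarrow> complex) \<Rightarrow> complex \<Rightarrow> bool" where
  "tensor_eigenvalue k I T l \<longleftrightarrow> (\<exists>x. tensor_eigenpair k I T l x)"

text \<open>
  The set of eigenvalues of a tensor with nonempty finite index set is finite and nonempty
  for \<open>k \<ge> 2\<close>, so this supremum is a maximum.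
\<close>

definition tensor_spectral_radius :: "nat \<Rightarrow> 'i set \<Rightarrow> ('i list \<Rightarrow> complex) \<Rightarrow> real" where
  "tensor_spectral_radius k I T = Sup {cmod l | l. tensor_eigenvalue k I T l}"


section \<open>The tensors of a hypergraph\<close>

definition adjacency_tensor :: "nat \<Rightarrow> 'a hypergraph \<Rightarrow> 'a list \<Rightarrow> real" where
  "adjacency_tensor k H js = (if set js \<in> edges H then 1 / fact (k - 1) else 0)"

definition degree_tensor :: "nat \<Rightarrow> 'a hypergraph \<Rightarrow> 'a list \<Rightarrow> real" where
  "degree_tensor k H js = (if js = replicate k (hd js) then real (degree H (hd js)) else 0)"

definition A_alpha_tensor :: "nat \<Rightarrow> real \<Rightarrow> 'a hypergraph \<Rightarrow> 'a list \<Rightarrow> complex" where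
  "A_alpha_tensor k \<alpha> H js =
     complex_of_real (\<alpha> * degree_tensor k H js + (1 - \<alpha>) * adjacency_tensor k H js)"

definition rho_alpha :: "nat \<Rightarrow> real \<Rightarrow> 'a hypergraph \<Rightarrow> real" where
  "rho_alpha k \<alpha> H = tensor_spectral_radius k (verts H) (A_alpha_tensor k \<alpha> H)"

text \<open>
  The Perron vector is determined only up to positive scaling, hence a predicate; the entries
  of \<open>x\<close> outside \<open>verts H\<close> are irrelevant.
\<close>

definition alpha_Perron_vector :: "nat \<Rightarrow> real \<Rightarrow> 'a hypergraph \<Rightarrow> ('a \<Rightarrow> real) \<Rightarrow> bool" where
  "alpha_Perron_vector k \<alpha> H x \<longleftrightarrow>
     (\<forall>v\<in>verts H. x v > 0) \<and>
     tensor_eigenpair k (verts H) (A_alpha_tensor k \<alpha> H)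
       (complex_of_real (rho_alpha k \<alpha> H)) (\<lambda>v. complex_of_real (x v))"

end

theory Submission
  imports "HOL-Analysis.Convex" "HOL-Combinatorics.Multiset_Permutations" Defs
begin

text \<open>
  Write \<open>m = k - 1\<close>. Comparing the eigenvalue equations at \<open>u\<close> and at its neighbours, with AM-GM
  for the products of entries, gives
  \<open>\<rho>\<^sup>2 \<le> \<alpha> d\<^sub>u\<^sup>2 + (1 - \<alpha>) / m * (\<Sum>w\<in>N(u). d\<^sub>w)\<close>. The degree sum counts, besides the edges
  at \<open>u\<close>, the incidences of the other edges with \<open>N(u)\<close>. If no Berge book exists, two vertices
  of a common edge \<open>e\<close> have at most \<open>(s - 1) (2 m - 1)\<close> common neighbours outside \<open>e\<close>: a larger
  set would greedily yield \<open>s\<close> pages. Applied to \<open>u\<close> and a neighbour, this bounds the edges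
  meeting \<open>N(u)\<close> at least twice. An edge meeting \<open>N(u)\<close> exactly once has \<open>m\<close> vertices
  at distance two from \<open>u\<close>; such a vertex \<open>z\<close> is linked in this way to at most \<open>t - 1\<close>
  edges at \<open>u\<close> as there is no Berge \<open>K\<^sub>2\<^sub>,\<^sub>t\<close>, and several links into the same edge at \<open>u\<close>
  make \<open>z\<close> a common neighbour of two vertices of that edge, which is rare by the book bound.
\<close>

section \<open>Berge copies of books and of complete bipartite graphs\<close>

text \<open>The witness keeps all vertices of \<open>H\<close> and takes exactly the image of
  \<open>\<phi>\<close> as its edges, so bijectivity reduces to injectivity.\<close>

lemma contains_BergeI:
  assumes "wf_hypergraph H" "inj_on f (verts G)" "f ` verts G \<subseteq> verts H"
    and "inj_on \<phi> (edges G)" "\<phi> ` edges G \<subseteq> edges H"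
    and "\<And>e. e \<in> edges G \<Longrightarrow> f ` e \<subseteq> \<phi> e"
  shows "contains_Berge H G"
proof -
  let ?F = "\<lparr>verts = verts H, edges = \<phi> ` edges G\<rparr>"
  have "subhypergraph ?F H"
    using assms(1,5) by (auto simp: subhypergraph_def wf_hypergraph_def)
  moreover have "is_Berge G ?F"
    unfolding is_Berge_def using assms by (intro exI[of _ f] exI[of _ \<phi>]) (auto simp: bij_betw_def)
  ultimately show ?thesis
    unfolding contains_Berge_def by blast
qed

lemma verts_book: "verts (book s) = verts (K2 s)"
  by (simp add: book_def K2_def)

lemma edges_book: "edges (book s) = insert {0, 1} (edges (K2 s))"
  by (simp add: book_def K2_def)

lemma edges_K2_cases:
  assumes "E \<in> edges (K2 t)"
  obtains j where "j \<in> {2..t + 1}" "E = {0, j}" | j where "j \<in> {2..t + 1}" "E = {1, j}"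
  using assms by (auto simp: K2_def)

lemma spine_notin_edges_K2: "{0, 1} \<notin> edges (K2 t)"
  by (auto simp: K2_def doubleton_eq_iff)

text \<open>The edges \<open>a y\<close> and \<open>b y\<close> carry the graph edges from
  \<open>y\<close> to \<open>p\<close> and to \<open>q\<close>. The maps \<open>f\<close> and
  \<open>\<phi>\<close> are exposed rather than hidden in \<open>contains_Berge\<close>, because the
  book extends them by one more edge.\<close>

lemma K2_embedding:
  assumes "p \<noteq> q" "finite Y" "card Y = r" "p \<notin> Y" "q \<notin> Y"
    and "inj_on a Y" "inj_on b Y" "a ` Y \<inter> b ` Y = {}"
    and "\<And>y. y \<in> Y \<Longrightarrow> p \<in> a y \<and> y \<in> a y \<and> q \<in> b y \<and> y \<in> b y"
  obtains f \<phi> where "f 0 = p" "f 1 = q" "inj_on f (verts (K2 r))"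
    "f ` verts (K2 r) \<subseteq> insert p (insert q Y)"
    "inj_on \<phi> (edges (K2 r))" "\<phi> ` edges (K2 r) \<subseteq> a ` Y \<union> b ` Y"
    "\<And>e. e \<in> edges (K2 r) \<Longrightarrow> f ` e \<subseteq> \<phi> e"
proof -
  have "card {2..r + 1} = card Y"
    using assms(3) by simp
  then obtain h where h: "bij_betw h {2..r + 1} Y"
    using finite_same_card_bij assms(2) by blast
  have hY: "h j \<in> Y" if "j \<in> {2..r + 1}" for j
    using h that by (auto simp: bij_betw_def)
  have hinj: "h i = h j \<longleftrightarrow> i = j" if "i \<in> {2..r + 1}" "j \<in> {2..r + 1}" for i j
    using h that by (auto simp: bij_betw_def inj_on_def)
  define f where "f i = (if i = 0 then p else if i = 1 then q else h i)" for i :: nat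
  \<comment> \<open>Graph edges are unordered. As \<open>j \<ge> 2\<close>, \<open>Max E\<close>
    recovers \<open>j\<close> from \<open>{0, j}\<close> and from \<open>{1, j}\<close>, and
    membership of 0 tells the two sides apart.\<close>
  define \<phi> where "\<phi> E = (if 0 \<in> E then a (h (Max E)) else b (h (Max E)))" for E :: "nat set"
  have f2: "f j = h j" if "j \<in> {2..r + 1}" for j
    using that by (auto simp: f_def)
  have \<phi>: "\<phi> {0, j} = a (h j)" "\<phi> {1, j} = b (h j)" if "j \<in> {2..r + 1}" for j
    using that by (auto simp: \<phi>_def max_def)
  have V: "verts (K2 r) = insert 0 (insert 1 {2..r + 1})"
    by (auto simp: K2_def)
  show ?thesis
  proof
    show "f 0 = p" "f 1 = q"
      by (auto simp: f_def)
    show "inj_on f (verts (K2 r))"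
    proof -
      have "f ` {2..r + 1} = Y"
        using h f2 by (auto simp: bij_betw_def)
      moreover have "inj_on f {2..r + 1}"
        using hinj f2 by (auto intro!: inj_onI)
      ultimately show ?thesis
        unfolding V using assms(1,4,5) by (auto simp: f_def)
    qed
    show "f ` verts (K2 r) \<subseteq> insert p (insert q Y)"
      unfolding V using hY by (auto simp: f_def)
    show "inj_on \<phi> (edges (K2 r))"
    proof (rule inj_onI)
      fix E E'
      assume "E \<in> edges (K2 r)" "E' \<in> edges (K2 r)" and eq: "\<phi> E = \<phi> E'"
      have ab: "a (h i) \<noteq> b (h j)" if "i \<in> {2..r + 1}" "j \<in> {2..r + 1}" for i j
        using hY[OF that(1)] hY[OF that(2)] assms(8) by blast
      have aa: "i = j" if "i \<in> {2..r + 1}" "j \<in> {2..r + 1}" "a (h i) = a (h j)" for i j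
        using hY[OF that(1)] hY[OF that(2)] that hinj assms(6) by (auto dest: inj_onD)
      have bb: "i = j" if "i \<in> {2..r + 1}" "j \<in> {2..r + 1}" "b (h i) = b (h j)" for i j
        using hY[OF that(1)] hY[OF that(2)] that hinj assms(7) by (auto dest: inj_onD)
      from \<open>E \<in> _\<close> \<open>E' \<in> _\<close> show "E = E'"
        by (elim edges_K2_cases; use eq \<phi> aa bb ab in metis)
    qed
    show "\<phi> ` edges (K2 r) \<subseteq> a ` Y \<union> b ` Y"
    proof (rule image_subsetI)
      fix E assume "E \<in> edges (K2 r)"
      then show "\<phi> E \<in> a ` Y \<union> b ` Y"
        by (elim edges_K2_cases) (use hY \<phi> in auto)
    qed
    show "f ` E \<subseteq> \<phi> E" if "E \<in> edges (K2 r)" for E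
      using that
    proof (cases rule: edges_K2_cases)
      case (1 j)
      then show ?thesis
        using \<phi>(1)[OF 1(1)] f2[OF 1(1)] assms(9)[OF hY[OF 1(1)]] by (auto simp: f_def)
    next
      case (2 j)
      then show ?thesis
        using \<phi>(2)[OF 2(1)] f2[OF 2(1)] assms(9)[OF hY[OF 2(1)]] by (auto simp: f_def)
    qed
  qed
qed

lemma contains_Berge_K2I:
  assumes "wf_hypergraph H" "p \<noteq> q" "finite Y" "card Y = r" "p \<notin> Y" "q \<notin> Y"
    and "inj_on a Y" "inj_on b Y" "a ` Y \<inter> b ` Y = {}"
    and "\<And>y. y \<in> Y \<Longrightarrow> p \<in> a y \<and> y \<in> a y \<and> q \<in> b y \<and> y \<in> b y"
    and "insert p (insert q Y) \<subseteq> verts H" "a ` Y \<union> b ` Y \<subseteq> edges H"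
  shows "contains_Berge H (K2 r)"
proof -
  obtain f \<phi> where f: "inj_on f (verts (K2 r))" "f ` verts (K2 r) \<subseteq> insert p (insert q Y)"
    "inj_on \<phi> (edges (K2 r))" "\<phi> ` edges (K2 r) \<subseteq> a ` Y \<union> b ` Y"
    "\<And>e. e \<in> edges (K2 r) \<Longrightarrow> f ` e \<subseteq> \<phi> e"
    using K2_embedding[OF assms(2-10)] by metis
  show ?thesis
    using subset_trans[OF f(2) assms(11)] subset_trans[OF f(4) assms(12)]
    by (rule contains_BergeI[OF assms(1) f(1) _ f(3) _ f(5)])
qed

lemma contains_Berge_bookI:
  assumes "wf_hypergraph H" "p \<noteq> q" "finite Y" "card Y = r" "p \<notin> Y" "q \<notin> Y"
    and "inj_on a Y" "inj_on b Y" "a ` Y \<inter> b ` Y = {}"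
    and "\<And>y. y \<in> Y \<Longrightarrow> p \<in> a y \<and> y \<in> a y \<and> q \<in> b y \<and> y \<in> b y"
    and "insert p (insert q Y) \<subseteq> verts H" "a ` Y \<union> b ` Y \<subseteq> edges H"
    and "e \<in> edges H" "p \<in> e" "q \<in> e" "e \<notin> a ` Y \<union> b ` Y"
  shows "contains_Berge H (book r)"
proof -
  obtain f \<phi> where f: "f 0 = p" "f 1 = q" "inj_on f (verts (K2 r))"
    "f ` verts (K2 r) \<subseteq> insert p (insert q Y)"
    "inj_on \<phi> (edges (K2 r))" "\<phi> ` edges (K2 r) \<subseteq> a ` Y \<union> b ` Y"
    "\<And>e. e \<in> edges (K2 r) \<Longrightarrow> f ` e \<subseteq> \<phi> e"
    using K2_embedding[OF assms(2-10)] by metis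
  \<comment> \<open>The spine is not an edge of \<open>K2 r\<close>, so overriding there leaves the
    page edges alone.\<close>
  define \<psi> where "\<psi> = \<phi>({0, 1} := e)"
  have \<psi>: "\<psi> E = \<phi> E" if "E \<in> edges (K2 r)" for E
    using that spine_notin_edges_K2[of r] by (auto simp: \<psi>_def)
  have \<psi>01: "\<psi> {0, 1} = e"
    by (simp add: \<psi>_def)
  have im: "\<psi> ` edges (K2 r) = \<phi> ` edges (K2 r)"
    using \<psi> by auto
  show ?thesis
  proof (rule contains_BergeI[of H f _ \<psi>])
    have "inj_on \<psi> (edges (K2 r))"
      using f(5) \<psi> inj_on_cong[of "edges (K2 r)" \<psi> \<phi>] by blast
    moreover have "\<psi> {0, 1} \<notin> \<psi> ` edges (K2 r)"
      using im \<psi>01 f(6) assms(16) by auto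
    ultimately show "inj_on \<psi> (edges (book r))"
      unfolding edges_book by (auto simp only: inj_on_insert)
    show "\<psi> ` edges (book r) \<subseteq> edges H"
      unfolding edges_book image_insert \<psi>01 im using f(6) assms(12,13) by blast
    show "f ` E \<subseteq> \<psi> E" if "E \<in> edges (book r)" for E
      using that f(1,2,7) assms(14,15) \<psi>01 \<psi> unfolding edges_book by auto
  qed (use assms f verts_book in auto)
qed

section \<open>Greedy selection without conflicts\<close>

text \<open>The induction picks \<open>w\<close>, deletes the at most \<open>c\<close> elements in
  conflict with it (among them \<open>w\<close>), and continues in the remainder. With more than
  \<open>r * c\<close> elements at the start, an element is still left after \<open>r\<close>
  rounds.\<close>

lemma conflict_free_subset:
  assumes "finite X" "\<And>w. w \<in> X \<Longrightarrow> card {v \<in> X. a v = a w \<or> b v = b w} \<le> c"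
    and "r * c < card X"
  shows "\<exists>Y\<subseteq>X. card Y = Suc r \<and> inj_on a Y \<and> inj_on b Y"
  using assms
proof (induction r arbitrary: X)
  case 0
  then obtain w where "w \<in> X"
    by fastforce
  then show ?case
    by (intro exI[of _ "{w}"]) auto
next
  case (Suc r)
  then obtain w where w: "w \<in> X"
    by fastforce
  let ?C = "{v \<in> X. a v = a w \<or> b v = b w}"
  have "card (X - ?C) = card X - card ?C"
    using Suc.prems(1) by (intro card_Diff_subset) auto
  then have "r * c < card (X - ?C)"
    using Suc.prems(2)[OF w] Suc.prems(3) by simp
  moreover have "card {v \<in> X - ?C. a v = a w' \<or> b v = b w'} \<le> c" if "w' \<in> X - ?C" for w'
  proof -
    have "card {v \<in> X - ?C. a v = a w' \<or> b v = b w'} \<le> card {v \<in> X. a v = a w' \<or> b v = b w'}"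
      using Suc.prems(1) by (intro card_mono) auto
    then show ?thesis
      using Suc.prems(2)[of w'] that by auto
  qed
  ultimately obtain Y where Y: "Y \<subseteq> X - ?C" "card Y = Suc r" "inj_on a Y" "inj_on b Y"
    using Suc.IH[of "X - ?C"] Suc.prems(1) by blast
  have "finite Y" "w \<notin> Y"
    using Y(1) Suc.prems(1) w finite_subset[of Y X] by auto
  then show ?case
    using Y w by (intro exI[of _ "insert w Y"]) (auto simp: inj_on_insert)
qed

section \<open>Counting in linear uniform hypergraphs\<close>

locale linear_k_graph =
  fixes H :: "'a hypergraph" and k :: nat
  assumes k_graph: "k_graph k H" and linear: "linear_hypergraph H"
begin

lemma wf: "wf_hypergraph H"
  using k_graph by (simp add: k_graph_def)

lemma finite_verts: "finite (verts H)"
  using wf by (simp add: wf_hypergraph_def)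

lemma edge_subset: "e \<in> edges H \<Longrightarrow> e \<subseteq> verts H"
  using wf by (simp add: wf_hypergraph_def)

lemma finite_edges: "finite (edges H)"
  using finite_verts edge_subset by (meson PowI finite_Pow_iff finite_subset subsetI)

lemma finite_edge: "e \<in> edges H \<Longrightarrow> finite e"
  using finite_verts edge_subset finite_subset by blast

lemma card_edge: "e \<in> edges H \<Longrightarrow> card e = k"
  using k_graph by (simp add: k_graph_def)

lemma card_edge_minus: "e \<in> edges H \<Longrightarrow> v \<in> e \<Longrightarrow> card (e - {v}) = k - 1"
  using card_edge finite_edge by simp

lemma edge_eqI:
  assumes "e \<in> edges H" "f \<in> edges H" "v \<noteq> w" "v \<in> e" "w \<in> e" "v \<in> f" "w \<in> f"
  shows "e = f"
proof (rule ccontr)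
  assume "e \<noteq> f"
  then have "card (e \<inter> f) \<le> 1"
    using linear assms by (auto simp: linear_hypergraph_def)
  moreover have "card {v, w} \<le> card (e \<inter> f)"
    using assms finite_edge by (intro card_mono) auto
  ultimately show False
    using assms(3) by simp
qed

text \<open>Join each common neighbour \<open>z\<close> to \<open>p\<close> by an edge
  \<open>a z\<close> and to \<open>q\<close> by an edge \<open>b z\<close>. Any \<open>s\<close>
  vertices on which both choices are injective form the pages of a Berge book whose spine is carried
  by \<open>e\<close>. The greedy selection finds them if there are too many candidates.\<close>

lemma card_common_neighbours_le:
  assumes "\<not> contains_Berge H (book s)" "s \<ge> 1" "e \<in> edges H" "p \<in> e" "q \<in> e" "p \<noteq> q"
  shows "card {z. z \<notin> e \<and> adjacent H p z \<and> adjacent H q z} \<le> (s - 1) * (2 * (k - 1) - 1)"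
proof (rule ccontr)
  let ?X = "{z. z \<notin> e \<and> adjacent H p z \<and> adjacent H q z}"
  assume "\<not> ?thesis"
  then have big: "(s - 1) * (2 * (k - 1) - 1) < card ?X"
    by simp
  have XV: "?X \<subseteq> verts H"
    using edge_subset by (auto simp: adjacent_def)
  then have "finite ?X"
    using finite_verts finite_subset by blast
  have "\<forall>z\<in>?X. \<exists>f. f \<in> edges H \<and> p \<in> f \<and> z \<in> f"
    by (auto simp: adjacent_def)
  from bchoice[OF this] obtain a
    where a: "\<And>z. z \<in> ?X \<Longrightarrow> a z \<in> edges H \<and> p \<in> a z \<and> z \<in> a z"
    by blast
  have "\<forall>z\<in>?X. \<exists>f. f \<in> edges H \<and> q \<in> f \<and> z \<in> f"
    by (auto simp: adjacent_def)
  from bchoice[OF this] obtain b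
    where b: "\<And>z. z \<in> ?X \<Longrightarrow> b z \<in> edges H \<and> q \<in> b z \<and> z \<in> b z"
    by blast
  \<comment> \<open>By linearity only \<open>e\<close> contains both \<open>p\<close> and
    \<open>q\<close>, and \<open>z\<close> lies outside \<open>e\<close>. Hence no edge serves both
    as some \<open>a z\<close> and as some \<open>b z'\<close>.\<close>
  have qa: "q \<notin> a z" and pb: "p \<notin> b z" if "z \<in> ?X" for z
    using a[OF that] b[OF that] edge_eqI[of e _ p q] assms(3-6) that by blast+
  have "card {v \<in> ?X. a v = a w \<or> b v = b w} \<le> 2 * (k - 1) - 1" if w: "w \<in> ?X" for w
  proof -
    let ?A = "a w - {p}" and ?B = "b w - {q}"
    have fin: "finite ?A" "finite ?B"
      using a[OF w] b[OF w] finite_edge by auto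
    have "{v \<in> ?X. a v = a w \<or> b v = b w} \<subseteq> ?A \<union> ?B"
      using a b assms(4,5) by blast
    then have "card {v \<in> ?X. a v = a w \<or> b v = b w} \<le> card (?A \<union> ?B)"
      using fin by (intro card_mono) auto
    moreover have "card ?A + card ?B = card (?A \<union> ?B) + card (?A \<inter> ?B)"
      using fin by (rule card_Un_Int)
    \<comment> \<open>Since \<open>w\<close> is counted in both sets, one is saved from
      \<open>2 * (k - 1)\<close>.\<close>
    moreover have "w \<in> ?A \<inter> ?B"
      using a[OF w] b[OF w] w assms(4,5) by blast
    then have "card (?A \<inter> ?B) \<ge> 1"
      using fin by (metis One_nat_def Suc_leI card_gt_0_iff empty_iff finite_Int)
    ultimately show ?thesis
      using a[OF w] b[OF w] card_edge_minus[of "a w" p] card_edge_minus[of "b w" q] by simp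
  qed
  from conflict_free_subset[OF \<open>finite ?X\<close> this big]
  obtain Y where Y: "Y \<subseteq> ?X" "card Y = s" "inj_on a Y" "inj_on b Y"
    using assms(2) by auto
  have "contains_Berge H (book s)"
  proof (rule contains_Berge_bookI[OF wf \<open>p \<noteq> q\<close> _ \<open>card Y = s\<close> _ _ Y(3,4)])
    show "finite Y"
      using Y(1) \<open>finite ?X\<close> finite_subset by blast
    show "p \<notin> Y" "q \<notin> Y"
      using Y(1) assms(4,5) by auto
    show "a ` Y \<inter> b ` Y = {}"
      using Y(1) a pb by blast
    show "p \<in> a y \<and> y \<in> a y \<and> q \<in> b y \<and> y \<in> b y" if "y \<in> Y" for y
      using a[of y] b[of y] that Y(1) by blast
    show "insert p (insert q Y) \<subseteq> verts H"
      using Y(1) XV assms(3-5) edge_subset by blast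
    show "a ` Y \<union> b ` Y \<subseteq> edges H"
      using Y(1) a b by blast
    show "e \<notin> a ` Y \<union> b ` Y"
      using Y(1) a b by blast
  qed (use assms in auto)
  then show False
    using assms(1) by blast
qed

section \<open>The surroundings of a vertex and the degree sum of its neighbours\<close>

definition star :: "'a \<Rightarrow> 'a set set" where
  "star u = {e \<in> edges H. u \<in> e}"

definition nbrs :: "'a \<Rightarrow> 'a set" where
  "nbrs u = {w. w \<noteq> u \<and> adjacent H u w}"

text \<open>All vertices at distance two or more are collected; only those at distance exactly two
  can have links.\<close>

definition far :: "'a \<Rightarrow> 'a set" where
  "far u = verts H - insert u (nbrs u)"

definition off_edges :: "'a \<Rightarrow> 'a set set" where
  "off_edges u = {f \<in> edges H. u \<notin> f}"

definition pendant_edges :: "'a \<Rightarrow> 'a set set" where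
  "pendant_edges u = {f \<in> off_edges u. card (f \<inter> nbrs u) = 1}"

definition links :: "'a \<Rightarrow> 'a \<Rightarrow> 'a set" where
  "links u z = {w \<in> nbrs u. \<exists>f\<in>pendant_edges u. z \<in> f \<and> w \<in> f}"

lemma nbrs_subset: "nbrs u \<subseteq> verts H"
  using edge_subset by (auto simp: nbrs_def adjacent_def)

lemma finite_nbrs: "finite (nbrs u)"
  using nbrs_subset finite_verts finite_subset by blast

lemma finite_links: "finite (links u z)"
  using finite_nbrs by (simp add: links_def)

lemma finite_far: "finite (far u)"
  using finite_verts by (simp add: far_def)

lemma finite_star: "finite (star u)"
  using finite_edges by (simp add: star_def)

lemma finite_off_edges: "finite (off_edges u)"
  using finite_edges by (simp add: off_edges_def)

lemma finite_pendant_edges: "finite (pendant_edges u)"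
  using finite_off_edges by (simp add: pendant_edges_def)

lemma degree_eq_card_star: "degree H u = card (star u)"
  by (simp add: degree_def star_def)

lemma nbrs_eq_UN: "nbrs u = (\<Union>e\<in>star u. e - {u})"
  by (auto simp: nbrs_def star_def adjacent_def)

text \<open>By linearity the edges at \<open>u\<close> meet only in \<open>u\<close>, so what
  remains of them partitions the neighbourhood.\<close>

lemma sum_nbrs: "(\<Sum>w\<in>nbrs u. g w) = (\<Sum>e\<in>star u. \<Sum>w\<in>e - {u}. g w)"
  unfolding nbrs_eq_UN
proof (rule sum.UNION_disjoint)
  show "\<forall>e\<in>star u. \<forall>f\<in>star u. e \<noteq> f \<longrightarrow> (e - {u}) \<inter> (f - {u}) = {}"
    using edge_eqI unfolding star_def by blast
qed (use finite_star finite_edge in \<open>auto simp: star_def\<close>)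

lemma card_nbrs: "card (nbrs u) = degree H u * (k - 1)"
proof -
  have "card (nbrs u) = (\<Sum>e\<in>star u. \<Sum>w\<in>e - {u}. 1)"
    using sum_nbrs[of "\<lambda>_. 1::nat" u] by simp
  also have "\<dots> = (\<Sum>e\<in>star u. k - 1)"
    using card_edge_minus by (intro sum.cong) (auto simp: star_def)
  finally show ?thesis
    by (simp add: degree_eq_card_star)
qed

lemma card_far:
  assumes "u \<in> verts H"
  shows "card (far u) + degree H u * (k - 1) + 1 = card (verts H)"
proof -
  have "u \<notin> nbrs u"
    by (simp add: nbrs_def)
  moreover have "card (far u) + card (insert u (nbrs u)) = card (verts H)"
    unfolding far_def using assms nbrs_subset finite_verts finite_nbrs
    by (metis card_Diff_subset card_mono finite_insert insert_subset le_add_diff_inverse2)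
  ultimately show ?thesis
    using card_nbrs finite_nbrs by simp
qed

text \<open>By linearity exactly one edge joins \<open>w\<close> to \<open>u\<close>; it accounts
  for the \<open>Suc\<close>.\<close>

lemma degree_nbr:
  assumes "w \<in> nbrs u"
  shows "degree H w = Suc (card {f \<in> off_edges u. w \<in> f})"
proof -
  obtain e where e: "e \<in> edges H" "u \<in> e" "w \<in> e" "w \<noteq> u"
    using assms by (auto simp: nbrs_def adjacent_def)
  have "{f \<in> edges H. w \<in> f} = insert e {f \<in> off_edges u. w \<in> f}"
  proof (intro equalityI subsetI)
    fix f assume "f \<in> {f \<in> edges H. w \<in> f}"
    then show "f \<in> insert e {f \<in> off_edges u. w \<in> f}"
      using edge_eqI[of f e u w] e by (cases "u \<in> f") (simp_all add: off_edges_def)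
  qed (use e in \<open>auto simp: off_edges_def\<close>)
  moreover have "e \<notin> {f \<in> off_edges u. w \<in> f}"
    using e by (simp add: off_edges_def)
  ultimately show ?thesis
    unfolding degree_def using finite_off_edges by simp
qed

lemma sum_degree_nbrs:
  "(\<Sum>w\<in>nbrs u. degree H w) = degree H u * (k - 1) + (\<Sum>f\<in>off_edges u. card (f \<inter> nbrs u))"
proof -
  have "(\<Sum>w\<in>nbrs u. degree H w) = card (nbrs u) + (\<Sum>w\<in>nbrs u. card {f \<in> off_edges u. w \<in> f})"
    by (simp add: degree_nbr sum_Suc add.commute)
  moreover have "(\<Sum>w\<in>nbrs u. card {f \<in> off_edges u. w \<in> f}) = (\<Sum>f\<in>off_edges u. card (f \<inter> nbrs u))"
    using finite_nbrs finite_off_edges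
    by (intro sum_multicount_gen) (auto intro!: arg_cong[of _ _ card])
  ultimately show ?thesis
    by (simp add: card_nbrs)
qed

text \<open>The sum counts ordered pairs of distinct neighbours \<open>v\<close>, \<open>w\<close>
  of \<open>u\<close> lying in an edge that avoids \<open>u\<close>; by linearity the pair
  determines that edge. For fixed \<open>v\<close>, each such \<open>w\<close> is a common neighbour
  of \<open>u\<close> and \<open>v\<close> outside the edge joining them, so the book bound
  applies.\<close>

lemma sum_off_edges_le:
  assumes "\<not> contains_Berge H (book s)" "s \<ge> 1"
  shows "(\<Sum>f\<in>off_edges u. card (f \<inter> nbrs u) * (card (f \<inter> nbrs u) - 1))
    \<le> degree H u * (k - 1) * ((s - 1) * (2 * (k - 1) - 1))"
proof -
  let ?D = "\<lambda>f. SIGMA v:f \<inter> nbrs u. f \<inter> nbrs u - {v}"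
  define X where "X v = {w \<in> nbrs u. \<exists>f\<in>off_edges u. v \<in> f \<and> w \<in> f \<and> v \<noteq> w}" for v
  have finX: "finite (X v)" for v
    using finite_nbrs by (simp add: X_def)
  have X: "card (X v) \<le> (s - 1) * (2 * (k - 1) - 1)" if "v \<in> nbrs u" for v
  proof -
    obtain e where e: "e \<in> edges H" "u \<in> e" "v \<in> e" "v \<noteq> u"
      using \<open>v \<in> nbrs u\<close> by (auto simp: nbrs_def adjacent_def)
    let ?C = "{z. z \<notin> e \<and> adjacent H u z \<and> adjacent H v z}"
    have "?C \<subseteq> verts H"
      using edge_subset by (auto simp: adjacent_def)
    then have "finite ?C"
      using finite_verts finite_subset by blast
    moreover have "X v \<subseteq> ?C"
    proof
      fix w assume "w \<in> X v"
      then obtain f where f: "f \<in> edges H" "u \<notin> f" "v \<in> f" "w \<in> f" "v \<noteq> w" and w: "w \<in> nbrs u"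
        by (auto simp: X_def off_edges_def)
      \<comment> \<open>Otherwise \<open>e\<close> and \<open>f\<close> share \<open>v\<close> and
        \<open>w\<close> and coincide, yet only \<open>e\<close> contains \<open>u\<close>.\<close>
      then have "w \<notin> e"
        using edge_eqI[of e f v w] e by blast
      then show "w \<in> ?C"
        using f w by (auto simp: nbrs_def adjacent_def)
    qed
    ultimately have "card (X v) \<le> card ?C"
      by (rule card_mono)
    also have "\<dots> \<le> (s - 1) * (2 * (k - 1) - 1)"
      using e by (intro card_common_neighbours_le[OF assms]) auto
    finally show ?thesis .
  qed
  have finD: "finite (?D f)" for f
    using finite_nbrs by auto
  have "(\<Sum>f\<in>off_edges u. card (f \<inter> nbrs u) * (card (f \<inter> nbrs u) - 1)) = (\<Sum>f\<in>off_edges u. card (?D f))"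
    using finite_nbrs by (intro sum.cong) (auto simp: card_Diff_singleton_if)
  also have "\<dots> = card (\<Union>f\<in>off_edges u. ?D f)"
  proof (rule card_UN_disjoint[symmetric])
    show "\<forall>f\<in>off_edges u. \<forall>g\<in>off_edges u. f \<noteq> g \<longrightarrow> ?D f \<inter> ?D g = {}"
      using edge_eqI unfolding off_edges_def by blast
  qed (use finite_off_edges finD in auto)
  also have "\<dots> \<le> card (SIGMA v:nbrs u. X v)"
    using finite_nbrs finX by (intro card_mono) (auto simp: X_def)
  also have "\<dots> = (\<Sum>v\<in>nbrs u. card (X v))"
    using finite_nbrs finX by simp
  also have "\<dots> \<le> card (nbrs u) * ((s - 1) * (2 * (k - 1) - 1))"
    using sum_bounded_above[of "nbrs u" "\<lambda>v. card (X v)"] X by simp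
  finally show ?thesis
    by (simp add: card_nbrs)
qed

section \<open>Links between distance two and the edges at the vertex\<close>

text \<open>One link chosen in each of \<open>t\<close> edges at \<open>u\<close> gives a Berge
  \<open>K2 t\<close> with \<open>u\<close> and \<open>z\<close> as the small part: the chosen links
  are joined to \<open>u\<close> by these edges and to \<open>z\<close> by pendant edges.\<close>

lemma card_star_links_le:
  assumes "\<not> contains_Berge H (K2 t)" "u \<in> verts H" "z \<in> far u"
  shows "card {e \<in> star u. links u z \<inter> e \<noteq> {}} \<le> t - 1"
proof (rule ccontr)
  let ?D = "{e \<in> star u. links u z \<inter> e \<noteq> {}}"
  assume "\<not> ?thesis"
  then have "t \<le> card ?D"
    by simp
  then obtain D where D: "D \<subseteq> ?D" "card D = t" "finite D"
    by (rule obtain_subset_with_card_n)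
  then have "\<forall>e\<in>D. \<exists>w. w \<in> links u z \<and> w \<in> e"
    by blast
  from bchoice[OF this] obtain y where y: "\<And>e. e \<in> D \<Longrightarrow> y e \<in> links u z \<and> y e \<in> e"
    by blast
  have D_star: "e \<in> edges H" "u \<in> e" if "e \<in> D" for e
    using that D(1) by (auto simp: star_def)
  have nbr: "w \<in> nbrs u" if "w \<in> links u z" for w
    using that by (simp add: links_def)
  have inj_y: "inj_on y D"
  proof (rule inj_onI)
    fix e f assume "e \<in> D" "f \<in> D" "y e = y f"
    then show "e = f"
      using y[of e] y[of f] D_star nbr edge_eqI[of e f u "y e"] by (auto simp: nbrs_def)
  qed
  have "\<forall>w\<in>y ` D. \<exists>f. f \<in> pendant_edges u \<and> z \<in> f \<and> w \<in> f"
    using y unfolding links_def by blast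
  from bchoice[OF this] obtain b
    where b: "\<And>w. w \<in> y ` D \<Longrightarrow> b w \<in> pendant_edges u \<and> z \<in> b w \<and> w \<in> b w"
    by blast
  have b_off: "b w \<in> edges H" "u \<notin> b w" "card (b w \<inter> nbrs u) = 1" if "w \<in> y ` D" for w
    using b[OF that] by (auto simp: pendant_edges_def off_edges_def)
  let ?a = "inv_into D y"
  have a: "?a (y e) = e" if "e \<in> D" for e
    using that inj_y by simp
  have "contains_Berge H (K2 t)"
  proof (rule contains_Berge_K2I[OF wf, of u z "y ` D" t ?a b])
    show "u \<noteq> z"
      using assms(3) by (auto simp: far_def)
    show "finite (y ` D)" "card (y ` D) = t"
      using D inj_y by (auto simp: card_image)
    show "u \<notin> y ` D" "z \<notin> y ` D"
      using y nbr assms(3) by (auto simp: far_def nbrs_def)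
    show "inj_on ?a (y ` D)"
      by (simp add: inj_on_inv_into)
    \<comment> \<open>A pendant edge has a single vertex in \<open>nbrs u\<close>, so it cannot
      serve two links.\<close>
    show "inj_on b (y ` D)"
    proof (rule inj_onI)
      fix v w assume vw: "v \<in> y ` D" "w \<in> y ` D" "b v = b w"
      then have "v \<in> b v \<inter> nbrs u" "w \<in> b v \<inter> nbrs u"
        using b y nbr by auto
      then show "v = w"
        using b_off(3)[OF vw(1)] by (metis card_1_singletonE singletonD)
    qed
    \<comment> \<open>Edges of the first kind contain \<open>u\<close>, pendant edges avoid
      it.\<close>
    show "?a ` y ` D \<inter> b ` y ` D = {}"
      using a D_star b_off by force
    show "u \<in> ?a w \<and> w \<in> ?a w \<and> z \<in> b w \<and> w \<in> b w" if "w \<in> y ` D" for w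
      using that a D_star y b by auto
    show "insert u (insert z (y ` D)) \<subseteq> verts H"
      using assms y nbr nbrs_subset by (auto simp: far_def)
    show "?a ` y ` D \<union> b ` y ` D \<subseteq> edges H"
      using a D_star b_off by auto
  qed
  then show False
    using assms(1) by blast
qed

text \<open>In each of the at most \<open>t - 1\<close> edges at \<open>u\<close> that contain a
  link, one link is charged to \<open>t - 1\<close> and the others to the pairs of links within that
  edge.\<close>

lemma card_links_le:
  assumes "\<not> contains_Berge H (K2 t)" "u \<in> verts H" "z \<in> far u"
  shows "2 * card (links u z) \<le> 2 * (t - 1) +
    (\<Sum>e\<in>star u. card (links u z \<inter> e) * (card (links u z \<inter> e) - 1))"
proof -
  let ?D = "{e \<in> star u. links u z \<inter> e \<noteq> {}}"
  let ?g = "\<lambda>e. card (links u z \<inter> e)"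
  have finD: "finite ?D"
    using finite_star by simp
  have "links u z \<subseteq> nbrs u"
    by (auto simp: links_def)
  then have "links u z = (\<Union>e\<in>?D. links u z \<inter> e)"
    unfolding nbrs_eq_UN by blast
  then have "card (links u z) \<le> (\<Sum>e\<in>?D. ?g e)"
    using card_UN_le[OF finD, of "\<lambda>e. links u z \<inter> e"] by simp
  then have "2 * card (links u z) \<le> (\<Sum>e\<in>?D. 2 * ?g e)"
    by (simp add: sum_distrib_left[symmetric])
  also have "\<dots> \<le> (\<Sum>e\<in>?D. 2 + ?g e * (?g e - 1))"
  proof (rule sum_mono)
    \<comment> \<open>Halving the number of ordered pairs here is what makes the final constant come out.\<close>
    have "2 * c \<le> 2 + c * (c - 1)" for c :: nat
      by (cases c; cases "c - 1") (auto simp: algebra_simps)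
    then show "2 * ?g e \<le> 2 + ?g e * (?g e - 1)" for e .
  qed
  also have "\<dots> = 2 * card ?D + (\<Sum>e\<in>?D. ?g e * (?g e - 1))"
    by (simp only: sum.distrib sum_constant mult.commute of_nat_id)
  also have "\<dots> \<le> 2 * (t - 1) + (\<Sum>e\<in>star u. ?g e * (?g e - 1))"
    using card_star_links_le[OF assms] finite_star by (intro add_mono sum_mono2) auto
  finally show ?thesis .
qed

text \<open>The order of counting is reversed: for fixed \<open>e\<close>, each of the
  \<open>(k - 1) * (k - 2)\<close> ordered pairs of distinct vertices of \<open>e - {u}\<close> can
  be a pair of links only for common neighbours \<open>z\<close> outside \<open>e\<close>, which the
  book bound limits.\<close>

lemma sum_links_pairs_le:
  assumes "\<not> contains_Berge H (book s)" "s \<ge> 1"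
  shows "(\<Sum>z\<in>far u. \<Sum>e\<in>star u. card (links u z \<inter> e) * (card (links u z \<inter> e) - 1))
    \<le> degree H u * ((k - 1) * (k - 2) * ((s - 1) * (2 * (k - 1) - 1)))"
proof -
  let ?c = "(s - 1) * (2 * (k - 1) - 1)"
  have "(\<Sum>z\<in>far u. card (links u z \<inter> e) * (card (links u z \<inter> e) - 1)) \<le> (k - 1) * (k - 2) * ?c"
    if e: "e \<in> star u" for e
  proof -
    have eH: "e \<in> edges H" "u \<in> e"
      using e by (auto simp: star_def)
    define P where "P = (SIGMA v:e - {u}. e - {u} - {v})"
    have fine: "finite e"
      using eH finite_edge by blast
    have finP: "finite P"
      using fine by (simp add: P_def)
    have cardP: "card P = (k - 1) * (k - 2)"
    proof -
      have "card P = (\<Sum>v\<in>e - {u}. card (e - {u} - {v}))"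
        unfolding P_def using fine by simp
      also have "\<dots> = (\<Sum>v\<in>e - {u}. k - 2)"
        using fine card_edge_minus[OF eH] by (intro sum.cong) (auto simp: card_Diff_singleton)
      finally show ?thesis
        using card_edge_minus[OF eH] by simp
    qed
    have "(\<Sum>z\<in>far u. card (links u z \<inter> e) * (card (links u z \<inter> e) - 1))
      = (\<Sum>z\<in>far u. card {p \<in> P. fst p \<in> links u z \<and> snd p \<in> links u z})"
    proof (rule sum.cong)
      fix z
      have "u \<notin> links u z"
        by (simp add: links_def nbrs_def)
      then have "{p \<in> P. fst p \<in> links u z \<and> snd p \<in> links u z}
        = (SIGMA v:links u z \<inter> e. links u z \<inter> e - {v})"
        by (auto simp: P_def)
      then show "card (links u z \<inter> e) * (card (links u z \<inter> e) - 1)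
        = card {p \<in> P. fst p \<in> links u z \<and> snd p \<in> links u z}"
        using finite_links by (simp add: card_Diff_singleton)
    qed simp
    also have "\<dots> = (\<Sum>p\<in>P. card {z \<in> far u. fst p \<in> links u z \<and> snd p \<in> links u z})"
      using finP finite_far by (intro sum_multicount_gen) auto
    also have "\<dots> \<le> card P * ?c"
    proof -
      have "card {z \<in> far u. fst p \<in> links u z \<and> snd p \<in> links u z} \<le> ?c" if pP: "p \<in> P" for p
      proof -
        obtain v w where p: "p = (v, w)" "v \<in> e" "w \<in> e" "v \<noteq> w"
          using pP by (auto simp: P_def)
        let ?C = "{z. z \<notin> e \<and> adjacent H v z \<and> adjacent H w z}"
        have "?C \<subseteq> verts H"
          using edge_subset by (auto simp: adjacent_def)
        then have "finite ?C"
          using finite_verts finite_subset by blast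
        moreover have "{z \<in> far u. fst p \<in> links u z \<and> snd p \<in> links u z} \<subseteq> ?C"
        proof
          fix z assume "z \<in> {z \<in> far u. fst p \<in> links u z \<and> snd p \<in> links u z}"
          then have z: "z \<in> far u" "v \<in> links u z" "w \<in> links u z"
            by (auto simp: p(1))
          \<comment> \<open>Apart from \<open>u\<close> itself, all vertices of \<open>e\<close> are
            neighbours of \<open>u\<close>, while \<open>z\<close> is far.\<close>
          have "z \<notin> e"
            using z(1) eH unfolding far_def nbrs_def adjacent_def by blast
          moreover have "adjacent H v z" "adjacent H w z"
            using z(2,3) unfolding adjacent_def links_def pendant_edges_def off_edges_def by blast+
          ultimately show "z \<in> ?C"
            by blast
        qed
        ultimately have "card {z \<in> far u. fst p \<in> links u z \<and> snd p \<in> links u z} \<le> card ?C"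
          by (rule card_mono)
        also have "\<dots> \<le> ?c"
          by (rule card_common_neighbours_le[OF assms eH(1) p(2-4)])
        finally show ?thesis .
      qed
      then show ?thesis
        using sum_bounded_above[of P "\<lambda>p. card {z \<in> far u. fst p \<in> links u z \<and> snd p \<in> links u z}" ?c]
        by simp
    qed
    finally show ?thesis
      by (simp add: cardP)
  qed
  then have "(\<Sum>e\<in>star u. \<Sum>z\<in>far u. card (links u z \<inter> e) * (card (links u z \<inter> e) - 1))
    \<le> card (star u) * ((k - 1) * (k - 2) * ?c)"
    using sum_bounded_above[of "star u"
        "\<lambda>e. \<Sum>z\<in>far u. card (links u z \<inter> e) * (card (links u z \<inter> e) - 1)"] by simp
  then show ?thesis
    by (subst sum.swap) (simp add: degree_eq_card_star)
qed

text \<open>Incidences of pendant edges with far vertices are counted twice. A pendant edge has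
  \<open>k - 1\<close> far vertices. Those through a fixed \<open>z\<close> are mapped to their
  vertex in \<open>nbrs u\<close>, injectively, since edges sharing that vertex and \<open>z\<close>
  coincide.\<close>

lemma card_pendant_edges_le: "(k - 1) * card (pendant_edges u) \<le> (\<Sum>z\<in>far u. card (links u z))"
proof -
  have "card {z \<in> far u. z \<in> f} = k - 1" if "f \<in> pendant_edges u" for f
  proof -
    have f: "f \<in> edges H" "u \<notin> f" "card (f \<inter> nbrs u) = 1"
      using that by (auto simp: pendant_edges_def off_edges_def)
    have "{z \<in> far u. z \<in> f} = f - f \<inter> nbrs u"
      using f edge_subset by (auto simp: far_def)
    then show ?thesis
      using f card_edge finite_edge by (simp add: card_Diff_subset)
  qed
  then have "(k - 1) * card (pendant_edges u) = (\<Sum>z\<in>far u. card {f \<in> pendant_edges u. z \<in> f})"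
    using finite_far finite_pendant_edges by (intro sum_multicount[symmetric]) auto
  also have "\<dots> \<le> (\<Sum>z\<in>far u. card (links u z))"
  proof (rule sum_mono)
    fix z assume z: "z \<in> far u"
    have "\<forall>f\<in>pendant_edges u. \<exists>w. w \<in> f \<inter> nbrs u"
      unfolding pendant_edges_def by (auto simp: card_1_singleton_iff)
    from bchoice[OF this] obtain g where g: "\<And>f. f \<in> pendant_edges u \<Longrightarrow> g f \<in> f \<inter> nbrs u"
      by blast
    show "card {f \<in> pendant_edges u. z \<in> f} \<le> card (links u z)"
    proof (rule card_inj_on_le)
      show "inj_on g {f \<in> pendant_edges u. z \<in> f}"
      proof (rule inj_onI)
        fix f f' assume ff: "f \<in> {f \<in> pendant_edges u. z \<in> f}" "f' \<in> {f \<in> pendant_edges u. z \<in> f}"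
          "g f = g f'"
        then have "f \<in> edges H" "f' \<in> edges H" "z \<in> f" "z \<in> f'" "g f \<in> f" "g f \<in> f'" "g f \<in> nbrs u"
          using g[of f] g[of f'] by (auto simp: pendant_edges_def off_edges_def)
        moreover have "z \<noteq> g f"
          using z \<open>g f \<in> nbrs u\<close> by (auto simp: far_def)
        ultimately show "f = f'"
          using edge_eqI by blast
      qed
      show "g ` {f \<in> pendant_edges u. z \<in> f} \<subseteq> links u z"
        using g by (auto simp: links_def)
    qed (rule finite_links)
  qed
  finally show ?thesis .
qed

section \<open>The bound on the degree sum\<close>

lemma sum_degree_nbrs_le:
  assumes "\<not> contains_Berge H (book s)" "s \<ge> 2" "\<not> contains_Berge H (K2 t)" "t \<ge> 1"
    and "u \<in> verts H" "k \<ge> 2"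
  shows "(real k - 1) * (\<Sum>w\<in>nbrs u. real (degree H w)) \<le>
    (real t - 1) * (real (card (verts H)) - 1) + (real k - 1) * (real (degree H u) *
      (((6 * (real k)\<^sup>2 - 15 * real k + 10) * (real s - 1) - 2 * (real t - 1)) / 2))"
proof -
  define m where "m = real k - 1"
  define d where "d = real (degree H u)"
  define A where "A = (\<Sum>f\<in>off_edges u. card (f \<inter> nbrs u))"
  define Q where "Q = (\<Sum>f\<in>off_edges u. card (f \<inter> nbrs u) * (card (f \<inter> nbrs u) - 1))"
  define R where "R = (\<Sum>z\<in>far u. \<Sum>e\<in>star u. card (links u z \<inter> e) * (card (links u z \<inter> e) - 1))"
  define P where "P = real (card (pendant_edges u))"
  define c where "c = (real s - 1) * (2 * m - 1)"
  have m: "m \<ge> 1" "real (k - 1) = m" "real (k - Suc 0) = m" "real (k - 2) = m - 1"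
    using assms(6) by (auto simp: m_def)
  have c: "real ((s - 1) * (2 * (k - 1) - 1)) = c"
    using assms(2,6) by (simp add: c_def m_def of_nat_diff)
  have "A \<le> card (pendant_edges u) + Q"
  proof -
    have "A \<le> (\<Sum>f\<in>off_edges u. (if card (f \<inter> nbrs u) = 1 then 1 else 0)
        + card (f \<inter> nbrs u) * (card (f \<inter> nbrs u) - 1))"
      unfolding A_def
    proof (rule sum_mono)
      \<comment> \<open>Edges meeting the neighbourhood once are kept apart for the link count; from
        two vertices on, ordered pairs dominate, with equality at \<open>a = 2\<close>.\<close>
      have "a \<le> (if a = 1 then 1 else 0) + a * (a - 1)" for a :: nat
        by (cases a; cases "a - 1") auto
      then show "card (f \<inter> nbrs u) \<le> (if card (f \<inter> nbrs u) = 1 then 1 else 0)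
        + card (f \<inter> nbrs u) * (card (f \<inter> nbrs u) - 1)" for f .
    qed
    also have "\<dots> = card (pendant_edges u) + Q"
      unfolding sum.distrib Q_def pendant_edges_def
      using finite_off_edges by (simp add: sum.If_cases Int_def)
    finally show ?thesis .
  qed
  then have A: "real A \<le> P + Q"
    unfolding P_def by linarith
  have "real Q \<le> real (degree H u * (k - 1) * ((s - 1) * (2 * (k - 1) - 1)))"
    unfolding Q_def using sum_off_edges_le[OF assms(1), of u] assms(2) by (intro of_nat_mono) simp
  then have Q: "real Q \<le> d * m * c"
    by (simp only: of_nat_mult[of _ "(s - 1) * (2 * (k - 1) - 1)"] c) (simp add: m d_def)
  have "real R \<le> real (degree H u * ((k - 1) * (k - 2) * ((s - 1) * (2 * (k - 1) - 1))))"
    unfolding R_def using sum_links_pairs_le[OF assms(1), of u] assms(2) by (intro of_nat_mono) simp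
  also have "\<dots> = d * (m * (m - 1) * c)"
    by (simp only: of_nat_mult[of _ "(s - 1) * (2 * (k - 1) - 1)"] of_nat_mult[of "degree H u"] c)
      (simp add: m d_def)
  finally have R: "real R \<le> d * (m * (m - 1) * c)" .
  have "2 * ((k - 1) * card (pendant_edges u)) \<le> (\<Sum>z\<in>far u. 2 * card (links u z))"
    using card_pendant_edges_le[of u] by (simp add: sum_distrib_left[symmetric])
  also have "\<dots> \<le> (\<Sum>z\<in>far u. 2 * (t - 1) +
      (\<Sum>e\<in>star u. card (links u z \<inter> e) * (card (links u z \<inter> e) - 1)))"
    using card_links_le[OF assms(3,5)] by (rule sum_mono)
  also have "\<dots> = card (far u) * (2 * (t - 1)) + R"
    by (simp add: sum.distrib R_def)
  finally have "real (2 * ((k - 1) * card (pendant_edges u))) \<le> real (card (far u) * (2 * (t - 1)) + R)"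
    by (rule of_nat_mono)
  then have P: "2 * (m * P) \<le> real (card (far u)) * (2 * (real t - 1)) + R"
    using assms(4) by (simp add: m P_def of_nat_diff)
  have "real (card (far u) + degree H u * (k - 1) + 1) = real (card (verts H))"
    using card_far[OF assms(5)] by simp
  \<comment> \<open>The exact number of far vertices, not just the bound \<open>n - 1\<close>,
    produces the negative term in \<open>t - 1\<close>.\<close>
  then have Z: "real (card (far u)) = real (card (verts H)) - 1 - d * m"
    by (simp add: m d_def)
  have S: "(\<Sum>w\<in>nbrs u. real (degree H w)) = d * m + A"
    using arg_cong[OF sum_degree_nbrs[of u], of real] by (simp add: m d_def A_def)
  have "m * real A \<le> m * P + m * (d * m * c)"
    using A Q m(1) by (metis add_left_mono distrib_left mult_left_mono order_trans zero_le_one)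
  then have "m * (d * m + A) \<le> m * (d * m) + m * (d * m * c)
      + ((real (card (verts H)) - 1 - d * m) * (real t - 1) + d * (m * (m - 1) * c) / 2)"
    using P R unfolding Z distrib_left by linarith
  also have "\<dots> = (real t - 1) * (real (card (verts H)) - 1)
      + m * (d * (m + m * c + (m - 1) * c / 2 - (real t - 1)))"
    by (simp add: field_simps)
  also have "\<dots> \<le> (real t - 1) * (real (card (verts H)) - 1)
      + m * (d * (((6 * m\<^sup>2 - 3 * m + 1) * (real s - 1) - 2 * (real t - 1)) / 2))"
  proof -
    \<comment> \<open>The lone \<open>m\<close> stems from the edges at \<open>u\<close>. As
      \<open>s \<ge> 2\<close>, it can be absorbed into a multiple of \<open>s - 1\<close>, like the
      terms in \<open>c\<close>.\<close>
    have "m * 1 \<le> m * (real s - 1)"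
      using assms(2) m(1) by (intro mult_left_mono) auto
    moreover have "m * c + (m - 1) * c / 2 + m * (real s - 1) = (6 * m\<^sup>2 - 3 * m + 1) * (real s - 1) / 2"
      by (simp add: c_def field_simps power2_eq_square)
    ultimately have "m + m * c + (m - 1) * c / 2 - (real t - 1)
      \<le> ((6 * m\<^sup>2 - 3 * m + 1) * (real s - 1) - 2 * (real t - 1)) / 2"
      by (simp add: diff_divide_distrib)
    then show ?thesis
      using m(1) by (intro add_left_mono mult_left_mono) (auto simp: d_def)
  qed
  also have "6 * m\<^sup>2 - 3 * m + 1 = 6 * (real k)\<^sup>2 - 15 * real k + 10"
    by (simp add: m_def field_simps power2_eq_square)
  finally show ?thesis
    unfolding S m_def d_def .
qed

end

section \<open>The eigenvalue equations\<close>

lemma finite_index_tuples: "finite I \<Longrightarrow> finite (index_tuples m I)"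
  using finite_lists_length_eq[of I m] by (simp add: index_tuples_def conj_commute)

lemma degree_tensor_row:
  assumes "finite (verts H)" "v \<in> verts H" "k \<ge> 1"
  shows "(\<Sum>js\<in>index_tuples (k - 1) (verts H). degree_tensor k H (v # js) * prod_list (map x js))
    = real (degree H v) * x v ^ (k - 1)"
proof -
  let ?r = "replicate (k - 1) v"
  have "replicate k v = v # ?r"
    using assms(3) by (cases k) auto
  then have "(\<Sum>js\<in>index_tuples (k - 1) (verts H). degree_tensor k H (v # js) * prod_list (map x js))
    = (\<Sum>js\<in>index_tuples (k - 1) (verts H). if js = ?r then real (degree H v) * x v ^ (k - 1) else 0)"
    by (intro sum.cong) (auto simp: degree_tensor_def prod_list_replicate)
  moreover have "?r \<in> index_tuples (k - 1) (verts H)"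
    using assms(2) by (auto simp: index_tuples_def)
  ultimately show ?thesis
    using finite_index_tuples[OF assms(1)] by (simp add: sum.delta)
qed

text \<open>AM-GM is applied to the powers \<open>x i ^ card S\<close>, whose geometric mean is the
  plain product.\<close>

lemma prod_le_mean_power:
  fixes x :: "'a \<Rightarrow> real"
  assumes "finite S" "S \<noteq> {}" "\<And>i. i \<in> S \<Longrightarrow> x i \<ge> 0"
  shows "real (card S) * (\<Prod>i\<in>S. x i) \<le> (\<Sum>i\<in>S. x i ^ card S)"
proof -
  let ?m = "card S"
  have m: "?m > 0"
    using assms by (simp add: card_gt_0_iff)
  have P: "(\<Prod>i\<in>S. x i) \<ge> 0"
    using assms(3) by (rule prod_nonneg)
  have "(\<Prod>i\<in>S. x i ^ ?m) powr (1 / ?m) = (\<Prod>i\<in>S. x i)"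
  proof (cases "(\<Prod>i\<in>S. x i) = 0")
    case True
    then show ?thesis
      using m by (simp add: prod_power_distrib[symmetric] zero_power)
  next
    case False
    then show ?thesis
      using m P by (simp add: prod_power_distrib[symmetric] powr_realpow[symmetric] powr_powr)
  qed
  then have "(\<Prod>i\<in>S. x i) \<le> (\<Sum>i\<in>S. x i ^ ?m / ?m)"
    using arith_geom_mean[OF assms(1,2), of "\<lambda>i. x i ^ ?m"] assms(3) by simp
  then show ?thesis
    using m by (simp add: sum_divide_distrib[symmetric] field_simps)
qed

context linear_k_graph
begin

text \<open>The tuples with nonzero coefficient are the orderings of \<open>e - {v}\<close> for the
  edges \<open>e\<close> at \<open>v\<close>. Each edge has \<open>fact (k - 1)\<close> of them,
  which cancels the normalisation.\<close>

lemma adjacency_tensor_row: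
  assumes "v \<in> verts H" "k \<ge> 1"
  shows "(\<Sum>js\<in>index_tuples (k - 1) (verts H). adjacency_tensor k H (v # js) * prod_list (map x js))
    = (\<Sum>e\<in>star v. \<Prod>w\<in>e - {v}. x w)"
proof -
  let ?I = "index_tuples (k - 1) (verts H)"
  let ?t = "\<lambda>js. prod_list (map x js) / fact (k - 1)"
  have "{js \<in> ?I. set (v # js) \<in> edges H} = (\<Union>e\<in>star v. permutations_of_set (e - {v}))"
  proof (intro equalityI subsetI)
    fix js assume "js \<in> {js \<in> ?I. set (v # js) \<in> edges H}"
    then have js: "length js = k - 1" "set (v # js) \<in> edges H"
      by (auto simp: index_tuples_def)
    \<comment> \<open>The tuple has \<open>k\<close> entries and its set is an edge of size
      \<open>k\<close>, so nothing repeats.\<close>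
    then have "card (set (v # js)) = length (v # js)"
      using card_edge assms(2) by simp
    then have "distinct (v # js)"
      by (rule card_distinct)
    then have "js \<in> permutations_of_set (set (v # js) - {v})"
      by (auto simp: permutations_of_set_def)
    then show "js \<in> (\<Union>e\<in>star v. permutations_of_set (e - {v}))"
      using js(2) by (auto simp: star_def)
  next
    fix js assume "js \<in> (\<Union>e\<in>star v. permutations_of_set (e - {v}))"
    then obtain e where e: "e \<in> edges H" "v \<in> e" "js \<in> permutations_of_set (e - {v})"
      by (auto simp: star_def)
    then have "length js = k - 1" "set js = e - {v}"
      using length_finite_permutations_of_set card_edge_minus permutations_of_setD
      by metis+
    moreover have "insert v (e - {v}) = e"
      using e(2) by blast
    ultimately show "js \<in> {js \<in> ?I. set (v # js) \<in> edges H}"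
      using e(1) edge_subset by (auto simp: index_tuples_def)
  qed
  moreover have "(\<Sum>js\<in>?I. adjacency_tensor k H (v # js) * prod_list (map x js))
    = sum ?t {js \<in> ?I. set (v # js) \<in> edges H}"
    using finite_index_tuples[OF finite_verts]
    by (subst sum.inter_filter) (auto simp: adjacency_tensor_def intro!: sum.cong)
  ultimately have "(\<Sum>js\<in>?I. adjacency_tensor k H (v # js) * prod_list (map x js))
    = sum ?t (\<Union>e\<in>star v. permutations_of_set (e - {v}))"
    by simp
  also have "\<dots> = (\<Sum>e\<in>star v. sum ?t (permutations_of_set (e - {v})))"
  proof (rule sum.UNION_disjoint)
    show "\<forall>e\<in>star v. \<forall>f\<in>star v. e \<noteq> f \<longrightarrow>
        permutations_of_set (e - {v}) \<inter> permutations_of_set (f - {v}) = {}"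
      by (auto simp: star_def dest!: permutations_of_setD(1))
  qed (use finite_star in auto)
  also have "\<dots> = (\<Sum>e\<in>star v. \<Prod>w\<in>e - {v}. x w)"
  proof (rule sum.cong)
    fix e assume "e \<in> star v"
    then have e: "e \<in> edges H" "v \<in> e"
      by (auto simp: star_def)
    have "sum ?t (permutations_of_set (e - {v}))
      = (\<Sum>js\<in>permutations_of_set (e - {v}). (\<Prod>w\<in>e - {v}. x w) / fact (k - 1))"
    proof (rule sum.cong)
      fix js assume "js \<in> permutations_of_set (e - {v})"
      then show "?t js = (\<Prod>w\<in>e - {v}. x w) / fact (k - 1)"
        by (metis permutations_of_setD prod.distinct_set_conv_list)
    qed simp
    also have "\<dots> = (\<Prod>w\<in>e - {v}. x w)"
      using card_edge_minus[OF e] finite_edge[OF e(1)] by simp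
    finally show "sum ?t (permutations_of_set (e - {v})) = (\<Prod>w\<in>e - {v}. x w)" .
  qed simp
  finally show ?thesis .
qed

text \<open>Tensor, eigenvalue and vector are all real, so the complex eigenvalue equation descends
  to the reals.\<close>

lemma Perron_equation:
  assumes "alpha_Perron_vector k \<alpha> H x" "v \<in> verts H" "k \<ge> 1"
  shows "rho_alpha k \<alpha> H * x v ^ (k - 1) =
    \<alpha> * (real (degree H v) * x v ^ (k - 1)) + (1 - \<alpha>) * (\<Sum>e\<in>star v. \<Prod>w\<in>e - {v}. x w)"
proof -
  let ?I = "index_tuples (k - 1) (verts H)"
  have *: "prod_list (map (\<lambda>w. complex_of_real (x w)) js) = complex_of_real (prod_list (map x js))" for js
    by (induction js) auto
  have "(\<Sum>js\<in>?I. A_alpha_tensor k \<alpha> H (v # js) * prod_list (map (\<lambda>w. complex_of_real (x w)) js))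
    = complex_of_real (rho_alpha k \<alpha> H) * complex_of_real (x v) ^ (k - 1)"
    using assms(1,2) by (simp add: alpha_Perron_vector_def tensor_eigenpair_def)
  then have "complex_of_real (\<Sum>js\<in>?I. (\<alpha> * degree_tensor k H (v # js)
      + (1 - \<alpha>) * adjacency_tensor k H (v # js)) * prod_list (map x js))
    = complex_of_real (rho_alpha k \<alpha> H * x v ^ (k - 1))"
    by (simp only: A_alpha_tensor_def * of_real_mult of_real_power of_real_sum)
  then have "rho_alpha k \<alpha> H * x v ^ (k - 1) = (\<Sum>js\<in>?I. (\<alpha> * degree_tensor k H (v # js)
      + (1 - \<alpha>) * adjacency_tensor k H (v # js)) * prod_list (map x js))"
    by (simp only: of_real_eq_iff)
  also have "\<dots> = \<alpha> * (\<Sum>js\<in>?I. degree_tensor k H (v # js) * prod_list (map x js))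
      + (1 - \<alpha>) * (\<Sum>js\<in>?I. adjacency_tensor k H (v # js) * prod_list (map x js))"
    by (simp only: sum_distrib_left distrib_right sum.distrib mult.assoc)
  finally show ?thesis
    using assms finite_verts by (simp only: degree_tensor_row adjacency_tensor_row)
qed

section \<open>From the spectral radius to the degree sum\<close>

text \<open>The equation at \<open>u\<close> is multiplied by \<open>\<rho>\<close>. AM-GM turns
  each product into powers of single entries, and the equations at the neighbours bound
  \<open>\<rho>\<close> times these powers by degrees times the maximal power
  \<open>X\<close>.\<close>

lemma rho_alpha_square_le:
  assumes "alpha_Perron_vector k \<alpha> H x" "0 \<le> \<alpha>" "\<alpha> \<le> 1" "k \<ge> 2"
    and "u \<in> verts H" "\<forall>v\<in>verts H. x v \<le> x u"
  shows "(rho_alpha k \<alpha> H)\<^sup>2 \<le> \<alpha> * (real (degree H u))\<^sup>2 +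
    (1 - \<alpha>) * ((\<Sum>w\<in>nbrs u. real (degree H w)) / (real k - 1))"
proof -
  define m where "m = k - 1"
  define \<rho> where "\<rho> = rho_alpha k \<alpha> H"
  define X where "X = x u ^ m"
  define p where "p v e = (\<Prod>w\<in>e - {v}. x w)" for v e
  define d where "d v = real (degree H v)" for v
  have m: "m \<ge> 1" "real m = real k - 1"
    using assms(4) by (auto simp: m_def)
  have x: "x v > 0" if "v \<in> verts H" for v
    using assms(1) that by (simp add: alpha_Perron_vector_def)
  have "X > 0"
    using x assms(5) by (simp add: X_def)
  have eq: "\<rho> * x v ^ m = \<alpha> * (d v * x v ^ m) + (1 - \<alpha>) * (\<Sum>e\<in>star v. p v e)" if "v \<in> verts H" for v
    using Perron_equation[OF assms(1) that] assms(4) by (simp add: \<rho>_def m_def p_def d_def)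
  have p: "0 \<le> p v e" "p v e \<le> X" if "e \<in> star v" for v e
  proof -
    have e: "e \<in> edges H" "v \<in> e"
      using that by (auto simp: star_def)
    then have xe: "0 \<le> x w \<and> x w \<le> x u" if "w \<in> e - {v}" for w
      using that edge_subset x assms(6) by (meson DiffD1 less_imp_le subsetD)
    then show "0 \<le> p v e"
      unfolding p_def by (intro prod_nonneg) auto
    have "p v e \<le> (\<Prod>w\<in>e - {v}. x u)"
      unfolding p_def using xe by (intro prod_mono) auto
    then show "p v e \<le> X"
      using card_edge_minus[OF e] by (simp add: X_def m_def)
  qed
  have le_d: "\<rho> * x v ^ m \<le> d v * X" if v: "v \<in> verts H" for v
  proof -
    have "x v ^ m \<le> X"
      unfolding X_def using x[OF v] assms(6) v by (intro power_mono) auto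
    then have "\<alpha> * (d v * x v ^ m) \<le> \<alpha> * (d v * X)"
      using assms(2) by (intro mult_left_mono) (auto simp: d_def)
    moreover have "(\<Sum>e\<in>star v. p v e) \<le> d v * X"
      unfolding d_def degree_eq_card_star using p(2) by (rule sum_bounded_above)
    then have "(1 - \<alpha>) * (\<Sum>e\<in>star v. p v e) \<le> (1 - \<alpha>) * (d v * X)"
      using assms(3) by (intro mult_left_mono) auto
    ultimately show ?thesis
      using eq[OF v] by (simp add: algebra_simps)
  qed
  \<comment> \<open>The sign of \<open>\<rho>\<close> is read off the equation at \<open>u\<close>;
    it is needed to multiply inequalities by \<open>\<rho>\<close>.\<close>
  have "\<rho> * X \<ge> 0"
    unfolding X_def eq[OF assms(5)] using assms(2,3) x[OF assms(5)] p(1)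
    by (intro add_nonneg_nonneg mult_nonneg_nonneg sum_nonneg) (auto simp: d_def)
  then have "\<rho> \<ge> 0"
    using \<open>X > 0\<close> by (simp add: zero_le_mult_iff)
  have step: "\<rho> * p u e \<le> (\<Sum>w\<in>e - {u}. d w) * X / m" if "e \<in> star u" for e
  proof -
    have e: "e \<in> edges H" "u \<in> e"
      using that by (auto simp: star_def)
    have ne: "finite (e - {u})" "card (e - {u}) = m"
      using card_edge_minus[OF e] finite_edge[OF e(1)] by (simp_all add: m_def)
    have "e - {u} \<noteq> {}"
      using ne(2) m(1) by (metis card.empty not_one_le_zero)
    have "real m * p u e \<le> (\<Sum>w\<in>e - {u}. x w ^ m)"
      using prod_le_mean_power[OF ne(1) \<open>e - {u} \<noteq> {}\<close>, of x] ne(2) x edge_subset[OF e(1)]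
      by (auto simp: p_def less_imp_le subset_iff)
    then have "\<rho> * (real m * p u e) \<le> \<rho> * (\<Sum>w\<in>e - {u}. x w ^ m)"
      using \<open>\<rho> \<ge> 0\<close> by (rule mult_left_mono)
    also have "\<dots> = (\<Sum>w\<in>e - {u}. \<rho> * x w ^ m)"
      by (rule sum_distrib_left)
    also have "\<dots> \<le> (\<Sum>w\<in>e - {u}. d w * X)"
      using le_d edge_subset[OF e(1)] by (intro sum_mono) auto
    also have "\<dots> = (\<Sum>w\<in>e - {u}. d w) * X"
      by (simp add: sum_distrib_right)
    finally show ?thesis
      using m(1) by (simp add: field_simps)
  qed
  have "\<rho>\<^sup>2 * X = \<rho> * (\<rho> * x u ^ m)"
    by (simp add: X_def power2_eq_square)
  also have "\<dots> = \<alpha> * (d u * (\<rho> * X)) + (1 - \<alpha>) * (\<Sum>e\<in>star u. \<rho> * p u e)"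
    unfolding eq[OF assms(5)] by (simp add: X_def algebra_simps sum_distrib_left)
  also have "\<dots> \<le> \<alpha> * (d u * (d u * X)) + (1 - \<alpha>) * (\<Sum>e\<in>star u. (\<Sum>w\<in>e - {u}. d w) * X / m)"
    using le_d[OF assms(5)] assms(2,3) step
    by (intro add_mono mult_left_mono sum_mono) (auto simp: d_def X_def)
  also have "(\<Sum>e\<in>star u. (\<Sum>w\<in>e - {u}. d w) * X / m) = (\<Sum>w\<in>nbrs u. d w) * X / m"
    unfolding sum_nbrs by (simp add: sum_distrib_right sum_divide_distrib)
  also have "\<alpha> * (d u * (d u * X)) + (1 - \<alpha>) * ((\<Sum>w\<in>nbrs u. d w) * X / m)
    = (\<alpha> * (d u)\<^sup>2 + (1 - \<alpha>) * ((\<Sum>w\<in>nbrs u. d w) / m)) * X"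
    by (simp add: algebra_simps power2_eq_square)
  finally show ?thesis
    using \<open>X > 0\<close> by (simp add: \<rho>_def d_def m(2))
qed

end

theorem theorem4p1:
  fixes H :: "'a hypergraph" and x :: "'a \<Rightarrow> real" and u :: 'a
    and n k s t :: nat and \<alpha> :: real
  assumes "n \<ge> 3" and "k \<ge> 3" and "s \<ge> 2" and "t \<ge> 1"
    and "0 \<le> \<alpha>" and "\<alpha> < 1"
    and "k_graph k H" and "connected_hypergraph H" and "linear_hypergraph H"
    and "card (verts H) = n"
    and "\<not> contains_Berge H (book s)"
    and "\<not> contains_Berge H (K2 t)"
    and "alpha_Perron_vector k \<alpha> H x"
    and "u \<in> verts H" and "\<forall>v\<in>verts H. x v \<le> x u"
  shows "(rho_alpha k \<alpha> H)\<^sup>2 \<le>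
    \<alpha> * (real (degree H u))\<^sup>2 +
    (1 - \<alpha>) *
      ((real t - 1) * (real n - 1) / (real k - 1)\<^sup>2 +
       ((6 * (real k)\<^sup>2 - 15 * real k + 10) * (real s - 1) - 2 * (real t - 1)) /
         (2 * (real k - 1)) * real (degree H u))"
proof -
  interpret linear_k_graph H k
    using assms by unfold_locales
  define m where "m = real k - 1"
  define C where "C = (6 * (real k)\<^sup>2 - 15 * real k + 10) * (real s - 1) - 2 * (real t - 1)"
  define S where "S = (\<Sum>w\<in>nbrs u. real (degree H w))"
  have m: "m > 0"
    using assms(2) by (simp add: m_def)
  have "m * S \<le> (real t - 1) * (real n - 1) + m * (real (degree H u) * (C / 2))"
    using sum_degree_nbrs_le[of s t u] assms unfolding m_def C_def S_def by simp
  \<comment> \<open>One factor \<open>m\<close> comes from the degree sum bound, the other from the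
    mean in the spectral bound.\<close>
  then have "m * S / m\<^sup>2 \<le> ((real t - 1) * (real n - 1) + m * (real (degree H u) * (C / 2))) / m\<^sup>2"
    by (rule divide_right_mono) simp
  then have "S / m \<le> (real t - 1) * (real n - 1) / m\<^sup>2 + C / (2 * m) * real (degree H u)"
    using m by (simp add: power2_eq_square add_divide_distrib mult.commute)
  then have "(1 - \<alpha>) * (S / m) \<le>
      (1 - \<alpha>) * ((real t - 1) * (real n - 1) / m\<^sup>2 + C / (2 * m) * real (degree H u))"
    using assms(6) by (intro mult_left_mono) auto
  moreover have "(rho_alpha k \<alpha> H)\<^sup>2 \<le> \<alpha> * (real (degree H u))\<^sup>2 + (1 - \<alpha>) * (S / m)"
    unfolding S_def m_def using assms by (intro rho_alpha_square_le[of \<alpha> x]) auto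
  ultimately show ?thesis
    unfolding m_def C_def by linarith
qed

end
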